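(* Let $X,Y,Z,U,V$ be locally convex Hausdorff topological vector spaces, and let $F\colon X\rightrightarrows Y$ and $G\colon Y\rightrightarrows Z$ be generalized polyhedral convex multifunctions whose graphs are given by $$\mathrm{gph}\,F=\big\{(x,y)\in X\times Y\;\big|\;A_1(x)+A_2(y)=u,\ \langle x_i^*,x\rangle+\langle y_{1,i}^*,y\rangle\le\alpha_i,\ i=1,\dots,p\big\},$$ $$\mathrm{gph}\,G=\big\{(y,z)\in Y\times Z\;\big|\;B_1(y)+B_2(z)=v,\ \langle y_{2,j}^*,y\rangle+\langle z_j^*,z\rangle\le\beta_j,\ j=1,\dots,q\big\},$$ where $A_1\colon X\to U$, $A_2\colon Y\to U$, $B_1\colon Y\to V$, $B_2\colon Z\to V$ are continuous linear mappings, $u\in U$, $v\in V$, $x_i^*\in X^*$, $y_{1,i}^*\in Y^*$, $\alpha_i\in\mathbb{R}$ for $i=1,\dots,p$, and $y_{2,j}^*\in Y^*$, $z_j^*\in Z^*$, $\beta_j\in\mathbb{R}$ for $j=1,\dots,q$. If the continuous linear mapping $(A_2,B_1)\colon Y\to U\times V$ defined by $(A_2,B_1)(y)=(A_2(y),B_1(y))$ for all $y\in Y$ is closed under finite-codimensional subspaces, then the multifunction $G\circ F\colon X\rightrightarrows Z$ is generalized polyhedral convex.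
   Context: All vector spaces are real. $X^*$ denotes the topological dual of $X$ and $\langle x^*,x\rangle$ the value of $x^*$ at $x$. A multifunction $F\colon X\rightrightarrows Y$ assigns to each $x\in X$ a (possibly empty) subset $F(x)\subset Y$; $\mathrm{gph}\,F=\{(x,y)\in X\times Y\mid y\in F(x)\}$. The composition is $(G\circ F)(x)=\bigcup_{y\in F(x)}G(y)$. A subset $D$ of a locally convex Hausdorff topological vector space $E$ is a generalized polyhedral convex set if there exist finitely many $e_i^*\in E^*$, $\alpha_i\in\mathbb{R}$, $i=1,\dots,m$, and a closed affine subspace $L\subset E$ such that $D=\{e\in E\mid e\in L,\ \langle e_i^*,e\rangle\le\alpha_i,\ i=1,\dots,m\}$ (the empty set is included). A multifunction is generalized polyhedral convex if its graph is a generalized polyhedral convex set in the product space. A continuous linear mapping $A\colon Y\to W$ is closed under finite-codimensional subspaces if $A(Y_0)$ is closed in $W$ for every closed linear subspace $Y_0\subset Y$ of finite codimension. *)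

theory Defs
  imports "HOL-Analysis.Analysis"
begin

class topological_real_vector = real_vector + topological_ab_group_add +
  assumes tendsto_scaleR_Pair:
    "LIM x (nhds c \<times>\<^sub>F nhds a). fst x *\<^sub>R snd x :> nhds (c *\<^sub>R a)"

text \<open>The second conjunct spells out \<open>convex W\<close>: the constant \<^const>\<open>convex\<close> has sort
  \<^class>\<open>real_vector\<close> and cannot occur in a class specification.\<close>

class locally_convex_t2_space = topological_real_vector + t2_space +
  assumes convex_nhds_zero_raw:
    "open S \<Longrightarrow> 0 \<in> S \<Longrightarrow>
      \<exists>W. open W \<and>
        (\<forall>x\<in>W. \<forall>y\<in>W. \<forall>s\<ge>0. \<forall>t\<ge>0. s + t = 1 \<longrightarrow> s *\<^sub>R x + t *\<^sub>R y \<in> W) \<and>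
        0 \<in> W \<and> W \<subseteq> S"

lemma convex_nhds_zero:
  fixes S :: "'a::locally_convex_t2_space set"
  assumes "open S" "0 \<in> S"
  shows "\<exists>W. open W \<and> convex W \<and> 0 \<in> W \<and> W \<subseteq> S"
  using convex_nhds_zero_raw[OF assms] unfolding convex_def .

lemma tendsto_scaleR_tvs:
  fixes b :: "'a::topological_real_vector"
  assumes "(f \<longlongrightarrow> a) F" "(g \<longlongrightarrow> b) F"
  shows "((\<lambda>x. f x *\<^sub>R g x) \<longlongrightarrow> a *\<^sub>R b) F"
  using filterlim_compose[OF tendsto_scaleR_Pair filterlim_Pair[OF assms]] by simp

instance real_normed_vector \<subseteq> locally_convex_t2_space
proof
  fix c :: real and a :: 'a
  show "LIM x (nhds c \<times>\<^sub>F nhds a). fst x *\<^sub>R snd x :> nhds (c *\<^sub>R a)"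
    by (rule tendsto_scaleR[OF filterlim_fst filterlim_snd])
next
  fix S :: "'a set"
  assume "open S" "0 \<in> S"
  then obtain e where "e > 0" "ball 0 e \<subseteq> S"
    using open_contains_ball by blast
  then show "\<exists>W. open W \<and>
        (\<forall>x\<in>W. \<forall>y\<in>W. \<forall>s\<ge>0. \<forall>t\<ge>0. s + t = 1 \<longrightarrow> s *\<^sub>R x + t *\<^sub>R y \<in> W) \<and>
        0 \<in> W \<and> W \<subseteq> S"
    unfolding convex_def[symmetric]
    using convex_ball[of 0 e] by (intro exI[of _ "ball 0 e"]) simp
qed

instance prod :: (topological_monoid_add, topological_monoid_add) topological_monoid_add
proof
  fix a b :: "'a \<times> 'b"
  have fst_lim: "filterlim fst (nhds (fst x)) (nhds x)"
    and snd_lim: "filterlim snd (nhds (snd x)) (nhds x)" for x :: "'a \<times> 'b"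
    by (rule tendsto_fst tendsto_snd, rule filterlim_ident)+
  show "LIM x (nhds a \<times>\<^sub>F nhds b). fst x + snd x :> nhds (a + b)"
    unfolding plus_prod_def
    by (rule tendsto_Pair; rule tendsto_add;
        rule filterlim_compose[OF fst_lim] filterlim_compose[OF snd_lim];
        rule filterlim_fst filterlim_snd)
qed

instance prod :: (topological_comm_monoid_add, topological_comm_monoid_add)
  topological_comm_monoid_add ..

instance prod :: (topological_group_add, topological_group_add) topological_group_add
proof
  fix a :: "'a \<times> 'b"
  show "filterlim uminus (nhds (- a)) (nhds a)"
    unfolding uminus_prod_def
    using tendsto_Pair[OF tendsto_minus[OF tendsto_fst[OF filterlim_ident]]
        tendsto_minus[OF tendsto_snd[OF filterlim_ident]]] .
qed

instance prod :: (topological_ab_group_add, topological_ab_group_add) topological_ab_group_add ..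

instance prod :: (topological_real_vector, topological_real_vector) topological_real_vector
proof
  fix a :: "'a \<times> 'b" and c :: real
  have fst_lim: "filterlim fst (nhds (fst x)) (nhds x)"
    and snd_lim: "filterlim snd (nhds (snd x)) (nhds x)" for x :: "'a \<times> 'b"
    by (rule tendsto_fst tendsto_snd, rule filterlim_ident)+
  show "LIM x (nhds c \<times>\<^sub>F nhds a). fst x *\<^sub>R snd x :> nhds (c *\<^sub>R a)"
    unfolding scaleR_prod_def
    by (rule tendsto_Pair; rule tendsto_scaleR_tvs;
        rule filterlim_fst filterlim_compose[OF fst_lim] filterlim_compose[OF snd_lim];
        rule filterlim_snd)
qed

instance prod :: (locally_convex_t2_space, locally_convex_t2_space) locally_convex_t2_space
proof
  fix S :: "('a \<times> 'b) set"
  assume "open S" "0 \<in> S"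
  then obtain A B where AB: "open A" "open B" "0 \<in> A \<times> B" "A \<times> B \<subseteq> S"
    by (rule open_prod_elim)
  then have zero: "0 \<in> A" "0 \<in> B"
    by (simp_all add: zero_prod_def)
  obtain W1 where W1: "open W1" "convex W1" "0 \<in> W1" "W1 \<subseteq> A"
    using convex_nhds_zero[OF AB(1) zero(1)] by blast
  obtain W2 where W2: "open W2" "convex W2" "0 \<in> W2" "W2 \<subseteq> B"
    using convex_nhds_zero[OF AB(2) zero(2)] by blast
  have "W1 \<times> W2 \<subseteq> S"
    using W1(4) W2(4) AB(4) by blast
  then show "\<exists>W. open W \<and>
        (\<forall>x\<in>W. \<forall>y\<in>W. \<forall>s\<ge>0. \<forall>t\<ge>0. s + t = 1 \<longrightarrow> s *\<^sub>R x + t *\<^sub>R y \<in> W) \<and>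
        0 \<in> W \<and> W \<subseteq> S"
    unfolding convex_def[symmetric]
    using open_Times[OF W1(1) W2(1)] convex_Times[OF W1(2) W2(2)] W1(3) W2(3)
    by (intro exI[of _ "W1 \<times> W2"]) (simp add: zero_prod_def)
qed

text \<open>For \<open>'b = real\<close>, this is membership in the topological dual of \<open>'a\<close>.\<close>

definition continuous_linear ::
    "('a::locally_convex_t2_space \<Rightarrow> 'b::locally_convex_t2_space) \<Rightarrow> bool" where
  "continuous_linear f \<longleftrightarrow> linear f \<and> continuous_on UNIV f"

text \<open>HOL's \<^const>\<open>affine\<close> also holds for the empty set; allowing it here adds nothing, since the
  empty set is already described by the zero functional and a negative bound.\<close>

definition generalized_polyhedral_convex :: "'a::locally_convex_t2_space set \<Rightarrow> bool" where
  "generalized_polyhedral_convex D \<longleftrightarrow>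
    (\<exists>(m::nat) (e :: nat \<Rightarrow> 'a \<Rightarrow> real) (\<alpha> :: nat \<Rightarrow> real) L.
      (\<forall>i\<in>{1..m}. continuous_linear (e i)) \<and> affine L \<and> closed L \<and>
      D = {x. x \<in> L \<and> (\<forall>i\<in>{1..m}. e i x \<le> \<alpha> i)})"

text \<open>A multifunction from \<open>'a\<close> to \<open>'b\<close> is a function \<open>'a \<Rightarrow> 'b set\<close>.\<close>

definition gph :: "('a \<Rightarrow> 'b set) \<Rightarrow> ('a \<times> 'b) set" where
  "gph F = {(x, y). y \<in> F x}"

definition mf_comp :: "('b \<Rightarrow> 'c set) \<Rightarrow> ('a \<Rightarrow> 'b set) \<Rightarrow> 'a \<Rightarrow> 'c set" where
  "mf_comp G F x = (\<Union>y\<in>F x. G y)"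

definition generalized_polyhedral_convex_mf ::
    "('a::locally_convex_t2_space \<Rightarrow> 'b::locally_convex_t2_space set) \<Rightarrow> bool" where
  "generalized_polyhedral_convex_mf F \<longleftrightarrow> generalized_polyhedral_convex (gph F)"

text \<open>A linear subspace has finite codimension iff it has a finite-dimensional algebraic
  complement (here \<open>span B\<close>).\<close>

definition finite_codimension :: "'a::real_vector set \<Rightarrow> bool" where
  "finite_codimension S \<longleftrightarrow>
    (\<exists>B. finite B \<and> S \<inter> span B = {0} \<and> {s + b | s b. s \<in> S \<and> b \<in> span B} = UNIV)"

definition closed_under_finite_codim_subspaces ::
    "('a::locally_convex_t2_space \<Rightarrow> 'b::locally_convex_t2_space) \<Rightarrow> bool" where
  "closed_under_finite_codim_subspaces A \<longleftrightarrow>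
    (\<forall>S. subspace S \<and> closed S \<and> finite_codimension S \<longrightarrow> closed (A ` S))"

end

theory Submission
  imports Defs
begin

text \<open>
  A pair \<open>(x, z)\<close> lies in the graph of the composition iff some \<open>y\<close> solves the linear equation
  \<open>(A1 x, B2 z) + (A2 y, B1 y) = (u, v)\<close> together with finitely many linear inequalities in
  \<open>(x, z)\<close> and \<open>y\<close>. The claim is therefore that the unknown \<open>y\<close>, from a space that may be
  infinite-dimensional, can be eliminated
  (\<open>generalized_polyhedral_convex_exists_solution\<close>).

  The elimination has two stages. On the common kernel \<open>N\<close> of the functionals of \<open>y\<close> in the
  inequalities, which is a closed subspace of finite codimension, the unknown only matters for the
  equation. Removing the component of \<open>y\<close> in \<open>N\<close> turns the equation into membership in the image
  of \<open>N\<close> under \<open>(A2, B1)\<close>, and this image is a closed subspace by hypothesis. What remains of \<open>y\<close>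
  are finitely many real coordinates, which are eliminated one by one: generalized polyhedral
  convexity survives adding a line (\<open>generalized_polyhedral_convex_plus_line\<close>).

  Adding a line is a projection along one direction \<open>e\<close>. Inside a closed affine set that is invariant
  under translation by \<open>e\<close> this is Fourier-Motzkin elimination. In a closed affine set that
  is not invariant, the coordinate along \<open>e\<close> is determined by the point, and one needs it to be the
  restriction of a continuous affine function on the whole space. This is where local convexity
  enters, through the Hahn-Banach theorem
  (\<open>functional_separating_point_from_closed_subspace\<close>), which is proved by enlarging a cone until it
  orders the space totally.
\<close>

section \<open>Separating a point from a closed subspace\<close>

text \<open>A maximal cone avoiding \<open>V\<close> must contain \<open>x\<close> or \<open>- x\<close>: otherwise enlarging it by either
  ray reaches \<open>V\<close>, and a convex combination of the two points reached, weighted so that the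
  multiples of \<open>x\<close> cancel, lies both in the cone and in \<open>V\<close>.\<close>
lemma maximal_cone_avoiding_convex_set:
  fixes C V :: "'a::real_vector set"
  assumes C: "convex_cone C" and V: "convex V" and disj: "C \<inter> V = {}"
  obtains K where "convex_cone K" "C \<subseteq> K" "K \<inter> V = {}" "\<forall>x. x \<in> K \<or> - x \<in> K"
proof -
  define \<A> where "\<A> = {K. convex_cone K \<and> C \<subseteq> K \<and> K \<inter> V = {}}"
  have "\<exists>K\<in>\<A>. \<forall>X\<in>\<A>. K \<subseteq> X \<longrightarrow> X = K"
  proof (rule subset_Zorn_nonempty)
    show "\<A> \<noteq> {}"
      using C disj by (auto simp: \<A>_def)
  next
    fix \<C> assume "\<C> \<noteq> {}" and chain: "subset.chain \<A> \<C>"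
    then have mem: "\<And>K. K \<in> \<C> \<Longrightarrow> convex_cone K \<and> C \<subseteq> K \<and> K \<inter> V = {}"
      by (auto simp: \<A>_def subset_chain_def)
    have "x + y \<in> \<Union>\<C>" if xy: "x \<in> \<Union>\<C>" "y \<in> \<Union>\<C>" for x y
    proof -
      obtain K1 K2 where K: "K1 \<in> \<C>" "x \<in> K1" "K2 \<in> \<C>" "y \<in> K2"
        using xy by blast
      then have "K1 \<subseteq> K2 \<or> K2 \<subseteq> K1"
        using chain by (auto simp: subset_chain_def)
      then show ?thesis
        using K mem convex_cone_add by (meson UnionI subsetD)
    qed
    moreover have "c *\<^sub>R x \<in> \<Union>\<C>" if "x \<in> \<Union>\<C>" "c \<ge> 0" for x c
      using that mem convex_cone_scaleR by (meson UnionE UnionI)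
    moreover have "0 \<in> \<Union>\<C>"
      using \<open>\<C> \<noteq> {}\<close> mem convex_cone_contains_0 by blast
    ultimately have "convex_cone (\<Union>\<C>)"
      by (simp add: convex_cone_iff)
    then show "\<Union>\<C> \<in> \<A>"
      using \<open>\<C> \<noteq> {}\<close> mem by (auto simp: \<A>_def)
  qed
  then obtain K where "K \<in> \<A>" and K_max: "\<And>X. X \<in> \<A> \<Longrightarrow> K \<subseteq> X \<Longrightarrow> X = K"
    by metis
  then have K: "convex_cone K" "C \<subseteq> K" "K \<inter> V = {}"
    by (auto simp: \<A>_def)
  have maximal: "X = K" if "convex_cone X" "C \<subseteq> X" "X \<inter> V = {}" "K \<subseteq> X" for X
    using that by (intro K_max) (auto simp: \<A>_def)
  \<comment> \<open>Maximality applied to the cone generated by \<open>K\<close> and \<open>x\<close>.\<close>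
  have meets: "\<exists>k\<in>K. \<exists>t>0. k + t *\<^sub>R x \<in> V" if "x \<notin> K" for x
  proof -
    define X where "X = {k + t *\<^sub>R x | k t. k \<in> K \<and> t \<ge> 0}"
    have "convex_cone X"
      unfolding convex_cone_iff
    proof (intro conjI ballI allI impI)
      show "0 \<in> X"
        unfolding X_def using convex_cone_contains_0[OF K(1)] by force
    next
      fix y z assume "y \<in> X" "z \<in> X"
      then obtain k t l s where "k \<in> K" "l \<in> K" "t \<ge> 0" "s \<ge> 0"
        "y = k + t *\<^sub>R x" "z = l + s *\<^sub>R x"
        unfolding X_def by blast
      then show "y + z \<in> X"
        unfolding X_def using convex_cone_add[OF K(1)]
        by (intro CollectI exI[of _ "k + l"] exI[of _ "t + s"]) (simp add: algebra_simps)
    next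
      fix y and c :: real assume "y \<in> X" "c \<ge> 0"
      then obtain k t where "k \<in> K" "t \<ge> 0" "y = k + t *\<^sub>R x"
        unfolding X_def by blast
      then show "c *\<^sub>R y \<in> X"
        unfolding X_def using convex_cone_scaleR[OF K(1)] \<open>c \<ge> 0\<close>
        by (intro CollectI exI[of _ "c *\<^sub>R k"] exI[of _ "c * t"]) (simp add: algebra_simps)
    qed
    moreover have "K \<subseteq> X"
      unfolding X_def by force
    moreover have "x \<in> X"
      unfolding X_def using convex_cone_contains_0[OF K(1)]
      by (intro CollectI exI[of _ 0] exI[of _ 1]) simp
    ultimately have "X \<inter> V \<noteq> {}"
      using maximal[of X] K(2) that by auto
    then obtain k t where "k \<in> K" "t \<ge> 0" "k + t *\<^sub>R x \<in> V"
      unfolding X_def by auto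
    moreover from this have "t \<noteq> 0"
      using K(3) by auto
    ultimately show ?thesis
      by (metis order_le_less)
  qed
  have "x \<in> K \<or> - x \<in> K" for x
  proof (rule ccontr)
    assume "\<not> (x \<in> K \<or> - x \<in> K)"
    then obtain k t l s where *: "k \<in> K" "t > 0" "k + t *\<^sub>R x \<in> V"
      "l \<in> K" "s > 0" "l + s *\<^sub>R (- x) \<in> V"
      using meets[of x] meets[of "- x"] by blast
    let ?z = "(s / (t + s)) *\<^sub>R (k + t *\<^sub>R x) + (t / (t + s)) *\<^sub>R (l + s *\<^sub>R (- x))"
    have "?z \<in> V"
      using * by (intro convexD[OF V]) (auto simp: add_divide_distrib[symmetric])
    moreover have "?z = (s / (t + s)) *\<^sub>R k + (t / (t + s)) *\<^sub>R l"
      by (simp add: algebra_simps)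
    moreover have "\<dots> \<in> K"
      using * by (intro convex_cone_add[OF K(1)] convex_cone_scaleR[OF K(1)]) auto
    ultimately show False
      using K(3) by auto
  qed
  then show ?thesis
    using that K by blast
qed

text \<open>Read \<open>x \<in> P\<close> as \<open>x \<ge> 0\<close>. This is a total preorder in which \<open>a\<close> is a positive order unit, so
  every \<open>x\<close> determines a Dedekind cut of the multiples of \<open>a\<close>: the multiples above \<open>x\<close> and those
  below. The position of the cut is the value of the functional at \<open>x\<close>. Because a cut position is
  unique, linearity only requires checking that sums and multiples of cuts are again cuts.\<close>
lemma total_cone_positive_functional:
  fixes P :: "'a::real_vector set"
  assumes P: "convex_cone P" and total: "\<And>x. x \<in> P \<or> - x \<in> P"
    and a: "- a \<notin> P" and unit: "\<And>x. \<exists>t. t *\<^sub>R a - x \<in> P"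
  obtains f :: "'a \<Rightarrow> real" where "linear f" "f a = 1" "\<And>x. x \<in> P \<Longrightarrow> f x \<ge> 0"
proof -
  note add = convex_cone_add[OF P] and scale = convex_cone_scaleR[OF P]
  have aP: "a \<in> P"
    using total a by blast
  have a_sign: "t \<ge> 0" if "t *\<^sub>R a \<in> P" for t
  proof (rule ccontr)
    assume "\<not> t \<ge> 0"
    then have "- a = (- 1 / t) *\<^sub>R (t *\<^sub>R a)" "- 1 / t \<ge> 0"
      by (auto simp: field_simps)
    then show False
      using scale[OF _ that] a by metis
  qed
  \<comment> \<open>\<open>R x r\<close>: the cut of \<open>x\<close> is at \<open>r\<close>. Nothing is required at \<open>t = r\<close>, since a
    cut may contain its endpoint on either side.\<close>
  define R where "R x r \<longleftrightarrow> (\<forall>t>r. t *\<^sub>R a - x \<in> P) \<and> (\<forall>t<r. x - t *\<^sub>R a \<in> P)" for x r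
  have R_unique: "r = s" if "R x r" "R x s" for x r s
  proof -
    have "r' \<le> s'" if R': "R x r'" "R x s'" for r' s'
    proof (rule ccontr)
      assume "\<not> r' \<le> s'"
      then obtain t t' where t: "s' < t" "t < t'" "t' < r'"
        by (meson dense not_le)
      then have "(t *\<^sub>R a - x) + (x - t' *\<^sub>R a) \<in> P"
        using R' by (intro add) (auto simp: R_def)
      then have "(t - t') *\<^sub>R a \<in> P"
        by (simp add: algebra_simps)
      then show False
        using a_sign t by fastforce
    qed
    then show ?thesis
      using that by (meson antisym)
  qed
  have R_exists: "\<exists>r. R x r" for x
  proof -
    define T where "T = {t. t *\<^sub>R a - x \<in> P}"
    have "T \<noteq> {}"
      using unit[of x] by (auto simp: T_def)
    obtain s where s: "s *\<^sub>R a - (- x) \<in> P"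
      using unit by blast
    have "- s \<le> t" if "t \<in> T" for t
    proof -
      have "(t *\<^sub>R a - x) + (s *\<^sub>R a - (- x)) \<in> P"
        using that s by (intro add) (auto simp: T_def)
      then have "(t + s) *\<^sub>R a \<in> P"
        by (simp add: algebra_simps)
      then show ?thesis
        using a_sign by fastforce
    qed
    then have bdd: "bdd_below T"
      by (auto simp: bdd_below_def)
    have "t *\<^sub>R a - x \<in> P" if t: "t > Inf T" for t
    proof -
      obtain t' where t': "t' \<in> T" "t' < t"
        using cInf_lessD[OF \<open>T \<noteq> {}\<close> t] by auto
      then have "(t' *\<^sub>R a - x) + (t - t') *\<^sub>R a \<in> P"
        using aP by (intro add scale) (auto simp: T_def)
      then show ?thesis
        by (simp add: algebra_simps)
    qed
    moreover have "x - t *\<^sub>R a \<in> P" if "t < Inf T" for t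
    proof -
      have "t \<notin> T"
        using that cInf_lower[OF _ bdd] by fastforce
      then show ?thesis
        using total[of "t *\<^sub>R a - x"] by (simp add: T_def)
    qed
    ultimately show ?thesis
      by (auto simp: R_def)
  qed
  have R_add: "R (x + y) (r + s)" if "R x r" "R y s" for x y r s
    unfolding R_def
  proof (intro conjI allI impI)
    \<comment> \<open>Split \<open>t\<close> into a part above \<open>r\<close> and a part above \<open>s\<close> by halving the excess \<open>t - r - s\<close>.\<close>
    fix t assume "t > r + s"
    then have "(((t + r - s) / 2) *\<^sub>R a - x) + (((t - r + s) / 2) *\<^sub>R a - y) \<in> P"
      using that by (intro add) (auto simp: R_def)
    moreover have "((t + r - s) / 2) + ((t - r + s) / 2) = t"
      by (simp add: field_simps)
    ultimately show "t *\<^sub>R a - (x + y) \<in> P"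
      by (metis add_diff_add scaleR_left_distrib)
  next
    fix t assume "t < r + s"
    then have "(x - ((t + r - s) / 2) *\<^sub>R a) + (y - ((t - r + s) / 2) *\<^sub>R a) \<in> P"
      using that by (intro add) (auto simp: R_def)
    moreover have "((t + r - s) / 2) + ((t - r + s) / 2) = t"
      by (simp add: field_simps)
    ultimately show "(x + y) - t *\<^sub>R a \<in> P"
      by (metis add_diff_add scaleR_left_distrib)
  qed
  have R_minus: "R (- x) (- r)" if "R x r" for x r
    unfolding R_def
  proof (intro conjI allI impI)
    fix t assume "t > - r"
    then have "x - (- t) *\<^sub>R a \<in> P"
      using that unfolding R_def by (metis minus_less_iff)
    then show "t *\<^sub>R a - - x \<in> P"
      by (simp add: add.commute)
  next
    fix t assume "t < - r"
    then have "(- t) *\<^sub>R a - x \<in> P"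
      using that unfolding R_def by (metis less_minus_iff)
    then show "- x - t *\<^sub>R a \<in> P"
      by (simp add: minus_diff_commute)
  qed
  have R_pos: "R (c *\<^sub>R x) (c * r)" if "R x r" "c > 0" for x r c
    unfolding R_def
  proof (intro conjI allI impI)
    fix t assume "t > c * r"
    then have "c *\<^sub>R ((t / c) *\<^sub>R a - x) \<in> P"
      using that by (intro scale) (auto simp: R_def field_simps)
    then show "t *\<^sub>R a - c *\<^sub>R x \<in> P"
      using \<open>c > 0\<close> by (simp add: algebra_simps)
  next
    fix t assume "t < c * r"
    then have "c *\<^sub>R (x - (t / c) *\<^sub>R a) \<in> P"
      using that by (intro scale) (auto simp: R_def field_simps)
    then show "c *\<^sub>R x - t *\<^sub>R a \<in> P"
      using \<open>c > 0\<close> by (simp add: algebra_simps)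
  qed
  have R_zero: "R 0 0"
    using R_add[OF _ R_minus] R_exists by fastforce
  have R_scale: "R (c *\<^sub>R x) (c * r)" if "R x r" for x r c
  proof (cases c "0::real" rule: linorder_cases)
    case less
    then show ?thesis
      using R_pos[OF R_minus[OF that], of "- c"] by simp
  qed (use that R_pos R_zero in auto)
  define f where "f x = (THE r. R x r)" for x
  have f: "R x (f x)" for x
    unfolding f_def using R_exists R_unique by (metis theI)
  show ?thesis
  proof
    show "linear f"
    proof (rule linearI)
      show "f (x + y) = f x + f y" for x y
        by (rule R_unique[OF f R_add[OF f f]])
      show "f (c *\<^sub>R x) = c *\<^sub>R f x" for c x
        using R_unique[OF f R_scale[OF f]] by simp
    qed
    have "R a 1"
      unfolding R_def
    proof (intro conjI allI impI)
      fix t :: real assume "t > 1"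
      then show "t *\<^sub>R a - a \<in> P"
        using scale[OF _ aP, of "t - 1"] by (simp add: algebra_simps)
    next
      fix t :: real assume "t < 1"
      then show "a - t *\<^sub>R a \<in> P"
        using scale[OF _ aP, of "1 - t"] by (simp add: algebra_simps)
    qed
    then show "f a = 1"
      using R_unique f by blast
  next
    fix x assume x: "x \<in> P"
    show "f x \<ge> 0"
    proof (rule ccontr)
      assume "\<not> f x \<ge> 0"
      then obtain t where t: "f x < t" "t < 0"
        using dense not_le by blast
      then have "(t *\<^sub>R a - x) + x \<in> P"
        using x f[of x] by (intro add) (auto simp: R_def)
      then show False
        using a_sign t by fastforce
    qed
  qed
qed

lemma continuous_on_scaleR_tvs:
  fixes g :: "'a::topological_space \<Rightarrow> 'b::topological_real_vector"
  assumes "continuous_on S f" "continuous_on S g"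
  shows "continuous_on S (\<lambda>x. f x *\<^sub>R g x)"
  using assms unfolding continuous_on_def by (blast intro: tendsto_scaleR_tvs)

lemma continuous_linear_if_bounded_near_zero:
  fixes f :: "'a::locally_convex_t2_space \<Rightarrow> real"
  assumes f: "linear f" and W: "open W" "0 \<in> W" and bound: "\<And>w. w \<in> W \<Longrightarrow> \<bar>f w\<bar> \<le> 1"
  shows "continuous_linear f"
  unfolding continuous_linear_def continuous_on_def
proof (intro conjI ballI)
  fix x :: 'a
  show "(f \<longlongrightarrow> f x) (at x)"
  proof (rule tendstoI)
    fix e :: real assume e: "e > 0"
    let ?g = "\<lambda>y. (2 / e) *\<^sub>R (y - x)"
    have "continuous_on UNIV ?g"
      by (intro continuous_on_scaleR_tvs continuous_intros)
    then have "open (?g -` W)"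
      using W(1) by (rule open_vimage[rotated])
    moreover have "x \<in> ?g -` W"
      using W(2) by simp
    moreover have "dist (f y) (f x) < e" if "y \<in> ?g -` W" for y
    proof -
      have "\<bar>(2 / e) * (f y - f x)\<bar> \<le> 1"
        using bound[of "?g y"] that by (simp add: linear_cmul[OF f] linear_diff[OF f])
      then have "\<bar>f y - f x\<bar> \<le> e / 2"
        using e unfolding abs_mult by (simp add: field_simps)
      then show ?thesis
        using e by (simp add: dist_real_def)
    qed
    ultimately show "\<forall>\<^sub>F y in at x. dist (f y) (f x) < e"
      unfolding eventually_at_topological by blast
  qed
qed (rule f)

text \<open>This is the form of the Hahn-Banach theorem needed below. A convex neighbourhood of \<open>- a\<close>
  misses the closed subspace \<open>M\<close>. A maximal cone \<open>P\<close> containing \<open>M\<close> and missing that neighbourhood is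
  total, and gives a functional that is nonnegative on \<open>P\<close>. Since \<open>M \<subseteq> P\<close> and \<open>M = - M\<close>, it vanishes
  on \<open>M\<close>; since \<open>a - w \<in> P\<close> for all small \<open>w\<close>, it is bounded near zero, hence continuous.\<close>
lemma functional_separating_point_from_closed_subspace:
  fixes M :: "'a::locally_convex_t2_space set"
  assumes M: "subspace M" "closed M" and a: "a \<notin> M"
  obtains f :: "'a \<Rightarrow> real" where "continuous_linear f" "\<And>x. x \<in> M \<Longrightarrow> f x = 0" "f a = 1"
proof -
  have "continuous_on UNIV (\<lambda>x. x - a)"
    by (intro continuous_intros)
  then have "open ((\<lambda>x. x - a) -` (- M))"
    using M(2) by (intro open_vimage) auto
  moreover have "0 \<in> (\<lambda>x. x - a) -` (- M)"
    using a subspace_neg[OF M(1)] by fastforce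
  ultimately obtain U where U: "open U" "convex U" "0 \<in> U" "U \<subseteq> (\<lambda>x. x - a) -` (- M)"
    using convex_nhds_zero by blast
  let ?V = "(\<lambda>x. x - a) ` U"
  have "convex_cone M"
    using M(1) by (simp add: convex_cone_iff subspace_def)
  moreover have "convex ?V"
    using U(2) by simp
  moreover have "M \<inter> ?V = {}"
    using U(4) by auto
  ultimately obtain P where P: "convex_cone P" "M \<subseteq> P" "P \<inter> ?V = {}"
    and total: "\<forall>x. x \<in> P \<or> - x \<in> P"
    by (rule maximal_cone_avoiding_convex_set)
  have near: "a - w \<in> P" if "w \<in> U" for w
  proof -
    have "w - a \<notin> P"
      using P(3) that by blast
    then show ?thesis
      using spec[OF total, of "w - a"] by simp
  qed
  \<comment> \<open>Neighbourhoods of zero are absorbing, so \<open>a\<close> is an order unit.\<close>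
  have "\<exists>t. t *\<^sub>R a - x \<in> P" for x
  proof -
    have "((\<lambda>r::real. r *\<^sub>R x) \<longlongrightarrow> 0 *\<^sub>R x) (at_right 0)"
      by (intro tendsto_scaleR_tvs tendsto_const tendsto_ident_at)
    then have "\<forall>\<^sub>F r in at_right 0. r *\<^sub>R x \<in> U"
      using U(1,3) by (simp add: topological_tendstoD)
    then have "\<forall>\<^sub>F r::real in at_right 0. r *\<^sub>R x \<in> U \<and> r > 0"
      using eventually_at_right_less by (rule eventually_conj)
    then obtain r :: real where r: "r *\<^sub>R x \<in> U" "r > 0"
      using eventually_happens'[OF trivial_limit_at_right_real] by blast
    have "(1 / r) *\<^sub>R (a - r *\<^sub>R x) \<in> P"
      using near[OF r(1)] r(2) by (intro convex_cone_scaleR[OF P(1)]) auto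
    then show ?thesis
      using r(2) by (auto simp: algebra_simps intro!: exI[of _ "1 / r"])
  qed
  moreover have "- a \<notin> P"
    using P(3) U(3) by force
  ultimately obtain f :: "'a \<Rightarrow> real" where f: "linear f" "f a = 1" "\<And>x. x \<in> P \<Longrightarrow> f x \<ge> 0"
    using total_cone_positive_functional[OF P(1) spec[OF total]] by metis
  show ?thesis
  proof
    have cont_minus: "continuous_on UNIV (\<lambda>x::'a. - x)"
      by (intro continuous_intros)
    show "continuous_linear f"
    proof (rule continuous_linear_if_bounded_near_zero[OF f(1)])
      show "open (U \<inter> uminus -` U)"
        using U(1) open_vimage[OF U(1) cont_minus] by blast
      show "\<bar>f w\<bar> \<le> 1" if "w \<in> U \<inter> uminus -` U" for w
        using f(3)[OF near[of w]] f(3)[OF near[of "- w"]] that f(2)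
        by (simp add: linear_diff[OF f(1)] linear_neg[OF f(1)] linear_add[OF f(1)])
    qed (use U(3) in simp)
  next
    fix x assume "x \<in> M"
    then have "x \<in> P" "- x \<in> P"
      using P(2) subspace_neg[OF M(1)] by auto
    then show "f x = 0"
      using f(3)[of x] f(3)[of "- x"] by (simp add: linear_neg[OF f(1)])
  qed (rule f(2))
qed

section \<open>Continuous linear maps\<close>

lemma continuous_linear_compose:
  "continuous_linear f \<Longrightarrow> continuous_linear g \<Longrightarrow> continuous_linear (\<lambda>x. f (g x))"
  unfolding continuous_linear_def
  using linear_compose[of g f] continuous_on_compose2[of UNIV f UNIV g] by (auto simp: o_def)

lemma continuous_linear_add:
  "continuous_linear f \<Longrightarrow> continuous_linear g \<Longrightarrow> continuous_linear (\<lambda>x. f x + g x)"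
  unfolding continuous_linear_def by (auto intro: linear_compose_add continuous_on_add)

lemma continuous_linear_Pair:
  "continuous_linear f \<Longrightarrow> continuous_linear g \<Longrightarrow> continuous_linear (\<lambda>x. (f x, g x))"
  unfolding continuous_linear_def
  by (auto simp: linear_iff intro: continuous_on_Pair)

lemma continuous_linear_ident: "continuous_linear (\<lambda>x. x)"
  unfolding continuous_linear_def by (simp add: linear_iff)

lemma continuous_linear_zero: "continuous_linear (\<lambda>x. 0)"
  unfolding continuous_linear_def by (simp add: linear_iff)

lemma continuous_linear_fst: "continuous_linear fst"
  unfolding continuous_linear_def by (simp add: linear_iff continuous_on_fst)

lemma continuous_linear_snd: "continuous_linear snd"
  unfolding continuous_linear_def by (simp add: linear_iff continuous_on_snd)

lemma continuous_linear_scaleR: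
  fixes f :: "'a::locally_convex_t2_space \<Rightarrow> real"
  assumes "continuous_linear f"
  shows "continuous_linear (\<lambda>x. f x *\<^sub>R e)"
  using assms unfolding continuous_linear_def
  by (auto simp: linear_iff algebra_simps intro!: continuous_on_scaleR_tvs continuous_on_const)

lemma continuous_linear_const_mult:
  fixes f :: "'a::locally_convex_t2_space \<Rightarrow> real"
  assumes "continuous_linear f"
  shows "continuous_linear (\<lambda>x. c * f x)"
  using continuous_linear_scaleR[OF assms, of c] by (simp add: mult.commute)

lemma continuous_linear_minus:
  "continuous_linear f \<Longrightarrow> continuous_linear (\<lambda>x. - f x)"
  unfolding continuous_linear_def by (auto intro: linear_compose_neg continuous_on_minus)

lemma continuous_linear_diff:
  "continuous_linear f \<Longrightarrow> continuous_linear g \<Longrightarrow> continuous_linear (\<lambda>x. f x - g x)"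
  using continuous_linear_add[OF _ continuous_linear_minus, of f g] by simp

lemma closed_affine_vimage:
  assumes f: "continuous_linear f" and L: "affine L" "closed L"
  shows "affine {x. f x + c \<in> L}" "closed {x. f x + c \<in> L}"
proof -
  have lin: "linear f" and cont: "continuous_on UNIV f"
    using f by (auto simp: continuous_linear_def)
  have "f ((1 - t) *\<^sub>R x + t *\<^sub>R y) + c = (1 - t) *\<^sub>R (f x + c) + t *\<^sub>R (f y + c)" for x y t
    by (simp only: linear_add[OF lin] linear_cmul[OF lin]) (simp add: algebra_simps)
  then show "affine {x. f x + c \<in> L}"
    using L(1) by (auto simp: affine_alt)
  have "closed ((\<lambda>x. f x + c) -` L)"
    using L(2) cont by (intro closed_vimage continuous_on_add continuous_on_const)
  then show "closed {x. f x + c \<in> L}"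
    by (simp add: vimage_def)
qed

section \<open>Generalized polyhedral convex sets\<close>

text \<open>Arbitrary finite index sets make it possible to combine families of inequalities by disjoint
  sums and products of index sets, instead of renumbering them.\<close>
lemma generalized_polyhedral_convexI:
  fixes f :: "'i \<Rightarrow> 'a::locally_convex_t2_space \<Rightarrow> real"
  assumes "finite I" and f: "\<And>i. i \<in> I \<Longrightarrow> continuous_linear (f i)"
    and "affine L" "closed L"
  shows "generalized_polyhedral_convex {x \<in> L. \<forall>i\<in>I. f i x \<le> b i}"
proof -
  obtain h and m :: nat where h: "h ` {1..m} = I"
    using ex_bij_betw_nat_finite_1[OF assms(1)] bij_betw_imp_surj_on by blast
  have "{x \<in> L. \<forall>i\<in>I. f i x \<le> b i} = {x. x \<in> L \<and> (\<forall>k\<in>{1..m}. (f \<circ> h) k x \<le> (b \<circ> h) k)}"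
    and "\<forall>k\<in>{1..m}. continuous_linear ((f \<circ> h) k)"
    using f unfolding h[symmetric] by auto
  then show ?thesis
    unfolding generalized_polyhedral_convex_def using assms(3,4) by blast
qed

lemma generalized_polyhedral_convexE:
  fixes D :: "'a::locally_convex_t2_space set"
  assumes "generalized_polyhedral_convex D"
  obtains I :: "nat set" and f :: "nat \<Rightarrow> 'a \<Rightarrow> real" and b :: "nat \<Rightarrow> real" and L where "finite I" "\<And>i. i \<in> I \<Longrightarrow> continuous_linear (f i)"
    "affine L" "closed L" "D = {x \<in> L. \<forall>i\<in>I. f i x \<le> b i}"
proof -
  obtain m :: nat and f :: "nat \<Rightarrow> 'a \<Rightarrow> real" and b :: "nat \<Rightarrow> real" and L where "\<forall>i\<in>{1..m}. continuous_linear (f i)" "affine L" "closed L"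
    "D = {x. x \<in> L \<and> (\<forall>i\<in>{1..m}. f i x \<le> b i)}"
    using assms unfolding generalized_polyhedral_convex_def by blast
  then show ?thesis
    by (intro that[of "{1..m}" f L b]) auto
qed

lemma generalized_polyhedral_convex_vimage:
  fixes h :: "'a::locally_convex_t2_space \<Rightarrow> 'b::locally_convex_t2_space"
  assumes D: "generalized_polyhedral_convex D" and h: "continuous_linear h"
  shows "generalized_polyhedral_convex {x. h x \<in> D}"
proof -
  obtain I :: "nat set" and f :: "nat \<Rightarrow> 'b \<Rightarrow> real" and b :: "nat \<Rightarrow> real" and L where D': "finite I" "\<And>i. i \<in> I \<Longrightarrow> continuous_linear (f i)"
    "affine L" "closed L" "D = {x \<in> L. \<forall>i\<in>I. f i x \<le> b i}"
    using D by (rule generalized_polyhedral_convexE) blast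
  have "generalized_polyhedral_convex {x \<in> {x. h x + 0 \<in> L}. \<forall>i\<in>I. f i (h x) \<le> b i}"
    by (intro generalized_polyhedral_convexI closed_affine_vimage continuous_linear_compose[OF _ h]
        D'(1-4) h)
  then show ?thesis
    by (simp add: D'(5))
qed

section \<open>Eliminating finitely many real unknowns\<close>

text \<open>Constraints with \<open>c i < 0\<close> bound \<open>t\<close> from below and those with \<open>c i > 0\<close> from above; a value of
  \<open>t\<close> exists iff each lower bound is at most each upper bound. The pairwise comparisons are
  multiplied by \<open>- c i * c j\<close>, which makes the result linear in \<open>a\<close>.\<close>
lemma fourier_motzkin:
  fixes a c :: "'i \<Rightarrow> real"
  assumes I: "finite I"
  shows "(\<exists>t. \<forall>i\<in>I. a i + t * c i \<le> b i) \<longleftrightarrow>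
    (\<forall>i\<in>I. c i = 0 \<longrightarrow> a i \<le> b i) \<and>
    (\<forall>i\<in>I. \<forall>j\<in>I. c i < 0 \<longrightarrow> c j > 0 \<longrightarrow> c j * a i - c i * a j \<le> c j * b i - c i * b j)"
    (is "?L \<longleftrightarrow> ?R")
proof
  assume ?L
  then obtain t where t: "\<And>i. i \<in> I \<Longrightarrow> a i + t * c i \<le> b i"
    by blast
  have "c j * a i - c i * a j \<le> c j * b i - c i * b j"
    if "i \<in> I" "j \<in> I" "c i < 0" "c j > 0" for i j
  proof -
    have "c j * (a i + t * c i) \<le> c j * b i" "- c i * (a j + t * c j) \<le> - c i * b j"
      using t that by (auto intro!: mult_left_mono)
    then show ?thesis
      by (simp add: algebra_simps)
  qed
  then show ?R
    using t by fastforce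
next
  assume R: ?R
  define lo where "lo = (\<lambda>i. (b i - a i) / c i) ` {i \<in> I. c i < 0}"
  define up where "up = (\<lambda>i. (b i - a i) / c i) ` {i \<in> I. c i > 0}"
  have fin: "finite lo" "finite up"
    using I by (auto simp: lo_def up_def)
  have lo_up: "l \<le> r" if lr: "l \<in> lo" "r \<in> up" for l r
  proof -
    obtain i where i: "i \<in> I" "c i < 0" "l = (b i - a i) / c i"
      using lr(1) unfolding lo_def by blast
    obtain j where j: "j \<in> I" "c j > 0" "r = (b j - a j) / c j"
      using lr(2) unfolding up_def by blast
    have "c j * a i - c i * a j \<le> c j * b i - c i * b j"
      using R i j by blast
    then have "(b j - a j) * c i / c j \<le> b i - a i"
      unfolding pos_divide_le_eq[OF j(2)] by (simp add: algebra_simps)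
    then show ?thesis
      using i j by (simp add: neg_divide_le_eq)
  qed
  have "\<exists>t. (\<forall>l\<in>lo. l \<le> t) \<and> (\<forall>r\<in>up. t \<le> r)"
  proof (cases "lo = {}")
    case True
    then show ?thesis
    proof (cases "up = {}")
      case False
      then show ?thesis
        using True fin by (intro exI[of _ "Min up"]) auto
    qed auto
  next
    case False
    then show ?thesis
      using lo_up fin by (intro exI[of _ "Max lo"]) auto
  qed
  then obtain t where t: "\<And>l. l \<in> lo \<Longrightarrow> l \<le> t" "\<And>r. r \<in> up \<Longrightarrow> t \<le> r"
    by blast
  have "a i + t * c i \<le> b i" if "i \<in> I" for i
  proof (cases "c i" "0::real" rule: linorder_cases)
    case less
    then have "(b i - a i) / c i \<le> t"
      using that by (intro t(1)) (auto simp: lo_def)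
    then show ?thesis
      using less by (simp add: field_simps)
  next
    case equal
    then show ?thesis
      using R that by simp
  next
    case greater
    then have "t \<le> (b i - a i) / c i"
      using that by (intro t(2)) (auto simp: up_def)
    then show ?thesis
      using greater by (simp add: field_simps)
  qed
  then show ?L
    by blast
qed

text \<open>Write \<open>D\<close> as the part of a closed affine set \<open>L\<close> cut out by finitely many inequalities. If \<open>e\<close>
  is a direction of \<open>L\<close>, membership in \<open>L\<close> does not depend on \<open>t\<close>, and Fourier-Motzkin elimination
  removes \<open>t\<close> from the inequalities. Otherwise a continuous functional vanishing on the directions
  of \<open>L\<close> and equal to 1 at \<open>e\<close> is constant on \<open>L\<close>, so the only possible \<open>t\<close> is a continuous affine
  function of \<open>x\<close>, which can be substituted.\<close>
lemma generalized_polyhedral_convex_plus_line: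
  fixes D :: "'a::locally_convex_t2_space set"
  assumes "generalized_polyhedral_convex D"
  shows "generalized_polyhedral_convex {x. \<exists>t. x + t *\<^sub>R e \<in> D}"
proof -
  obtain I :: "nat set" and f :: "nat \<Rightarrow> 'a \<Rightarrow> real" and b :: "nat \<Rightarrow> real" and L where I: "finite I"
    and f: "\<And>i. i \<in> I \<Longrightarrow> continuous_linear (f i)"
    and L: "affine L" "closed L" and D: "D = {x \<in> L. \<forall>i\<in>I. f i x \<le> b i}"
    using assms by (rule generalized_polyhedral_convexE) blast
  have f_line: "f i (x + t *\<^sub>R e) = f i x + t * f i e" if "i \<in> I" for i x t
    using f[OF that] by (simp add: continuous_linear_def linear_add linear_cmul)
  consider "L = {}" | l where "l \<in> L" "l + e \<in> L" | l where "l \<in> L" "l + e \<notin> L"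
    by blast
  then show ?thesis
  proof cases
    case 1
    then show ?thesis
      using assms D by simp
  next
    case 2
    have shift: "x + t *\<^sub>R e \<in> L" if "x \<in> L" for x t
      using mem_affine_3_minus[OF L(1) that 2(2,1), of t] by simp
    have shift_iff: "x + t *\<^sub>R e \<in> L \<longleftrightarrow> x \<in> L" for x t
      using shift[of x t] shift[of "x + t *\<^sub>R e" "- t"] by auto
    \<comment> \<open>The constraints without \<open>t\<close>, and one constraint for each pair of a lower and an upper bound.\<close>
    define J where "J = {i \<in> I. f i e = 0} <+> {i \<in> I. f i e < 0} \<times> {i \<in> I. f i e > 0}"
    have ball_J: "(\<forall>k\<in>J. P k) \<longleftrightarrow> (\<forall>i\<in>I. f i e = 0 \<longrightarrow> P (Inl i)) \<and>
        (\<forall>i\<in>I. \<forall>j\<in>I. f i e < 0 \<longrightarrow> f j e > 0 \<longrightarrow> P (Inr (i, j)))" for P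
      unfolding J_def by blast
    define g where "g = case_sum f (\<lambda>(i, j) x. f j e * f i x - f i e * f j x)"
    define d where "d = case_sum b (\<lambda>(i, j). f j e * b i - f i e * b j)"
    have "generalized_polyhedral_convex {x \<in> L. \<forall>k\<in>J. g k x \<le> d k}"
      using I L f unfolding J_def g_def
      by (intro generalized_polyhedral_convexI)
        (auto intro!: continuous_linear_diff continuous_linear_const_mult)
    moreover have "(\<exists>t. x + t *\<^sub>R e \<in> D) \<longleftrightarrow> x \<in> L \<and> (\<forall>k\<in>J. g k x \<le> d k)" for x
    proof -
      have "(\<exists>t. x + t *\<^sub>R e \<in> D) \<longleftrightarrow> x \<in> L \<and> (\<exists>t. \<forall>i\<in>I. f i x + t * f i e \<le> b i)"
        by (simp add: D shift_iff f_line)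
      also have "\<dots> \<longleftrightarrow> x \<in> L \<and> (\<forall>k\<in>J. g k x \<le> d k)"
        unfolding fourier_motzkin[OF I] ball_J g_def d_def
        by (simp only: sum.case prod.case)
      finally show ?thesis .
    qed
    ultimately show ?thesis
      by simp
  next
    case 3
    define M where "M = {d. d + l \<in> L}"
    have M: "subspace M" "closed M"
    proof -
      have "affine M" "closed M"
        unfolding M_def using closed_affine_vimage[OF continuous_linear_ident L] by auto
      moreover have "0 \<in> M"
        using 3(1) by (simp add: M_def)
      ultimately show "subspace M" "closed M"
        by (simp_all add: subspace_affine)
    qed
    have "e \<notin> M"
      using 3(2) by (simp add: M_def add.commute)
    then obtain \<psi> :: "'a \<Rightarrow> real" where \<psi>: "continuous_linear \<psi>" "\<And>x. x \<in> M \<Longrightarrow> \<psi> x = 0" "\<psi> e = 1"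
      using functional_separating_point_from_closed_subspace[OF M] by metis
    have lin: "linear \<psi>"
      using \<psi>(1) by (simp add: continuous_linear_def)
    have \<psi>_L: "\<psi> x = \<psi> l" if "x \<in> L" for x
      using \<psi>(2)[of "x - l"] that by (simp add: M_def linear_diff[OF lin])
    \<comment> \<open>\<open>?r x + \<psi> l *\<^sub>R e\<close> is the only point of the line through \<open>x\<close> that can lie in \<open>L\<close>.\<close>
    let ?r = "\<lambda>x. x - \<psi> x *\<^sub>R e"
    have r: "continuous_linear ?r"
      by (intro continuous_linear_diff continuous_linear_ident continuous_linear_scaleR \<psi>(1))
    have "generalized_polyhedral_convex
        {x \<in> {x. ?r x + \<psi> l *\<^sub>R e \<in> L}. \<forall>i\<in>I. f i (?r x) \<le> b i - \<psi> l * f i e}"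
      by (intro generalized_polyhedral_convexI closed_affine_vimage I L r
          continuous_linear_compose[OF f r])
    moreover have "(\<exists>t. x + t *\<^sub>R e \<in> D) \<longleftrightarrow>
        ?r x + \<psi> l *\<^sub>R e \<in> L \<and> (\<forall>i\<in>I. f i (?r x) \<le> b i - \<psi> l * f i e)" for x
    proof -
      have "x + t *\<^sub>R e \<in> D \<Longrightarrow> t = \<psi> l - \<psi> x" for t
        using \<psi>_L[of "x + t *\<^sub>R e"] \<psi>(3)
        by (simp add: D linear_add[OF lin] linear_cmul[OF lin])
      then have "(\<exists>t. x + t *\<^sub>R e \<in> D) \<longleftrightarrow> x + (\<psi> l - \<psi> x) *\<^sub>R e \<in> D"
        by blast
      also have "x + (\<psi> l - \<psi> x) *\<^sub>R e = ?r x + \<psi> l *\<^sub>R e"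
        by (simp add: algebra_simps)
      also have "?r x + \<psi> l *\<^sub>R e \<in> D \<longleftrightarrow>
          ?r x + \<psi> l *\<^sub>R e \<in> L \<and> (\<forall>i\<in>I. f i (?r x) \<le> b i - \<psi> l * f i e)"
        by (simp add: D f_line le_diff_eq)
      finally show ?thesis .
    qed
    ultimately show ?thesis
      by simp
  qed
qed

lemma generalized_polyhedral_convex_plus_span:
  assumes "finite B" "generalized_polyhedral_convex D"
  shows "generalized_polyhedral_convex {x. \<exists>s\<in>span B. x + s \<in> D}"
  using assms
proof (induction B arbitrary: D)
  case empty
  then show ?case
    by simp
next
  case (insert e B)
  have "{x. \<exists>s\<in>span (insert e B). x + s \<in> D} = {x. \<exists>s\<in>span B. x + s \<in> {x. \<exists>t. x + t *\<^sub>R e \<in> D}}"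
    (is "?L = ?R")
  proof
    show "?L \<subseteq> ?R"
    proof
      fix x assume "x \<in> ?L"
      then obtain s t where "s - t *\<^sub>R e \<in> span B" "x + s \<in> D"
        by (auto simp: span_insert)
      then show "x \<in> ?R"
        by (auto intro!: bexI[of _ "s - t *\<^sub>R e"] exI[of _ t] simp: algebra_simps)
    qed
    show "?R \<subseteq> ?L"
    proof
      fix x assume "x \<in> ?R"
      then obtain s t where "s \<in> span B" "x + s + t *\<^sub>R e \<in> D"
        by auto
      then show "x \<in> ?L"
        by (auto simp: span_insert add.assoc intro!: exI[of _ "s + t *\<^sub>R e"] exI[of _ t])
    qed
  qed
  then show ?case
    by (simp only:) (intro insert.IH generalized_polyhedral_convex_plus_line insert.prems)
qed

section \<open>Eliminating an unknown from an arbitrary space\<close>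

text \<open>If \<open>g\<close> does not vanish on \<open>S\<close>, a vector \<open>c\<close> of \<open>S\<close> with \<open>g c \<noteq> 0\<close> spans the one dimension that
  is lost, so it is added to the complement of \<open>S\<close>.\<close>
lemma finite_codimension_Int_kernel:
  fixes g :: "'a::real_vector \<Rightarrow> real"
  assumes S: "subspace S" "finite_codimension S" and g: "linear g"
  shows "finite_codimension (S \<inter> {x. g x = 0})"
proof (cases "\<exists>c\<in>S. g c \<noteq> 0")
  case False
  then have "S \<inter> {x. g x = 0} = S"
    by auto
  then show ?thesis
    using S(2) by simp
next
  case True
  then obtain c where c: "c \<in> S" "g c \<noteq> 0"
    by blast
  obtain B where B: "finite B" "S \<inter> span B = {0}" "{s + b | s b. s \<in> S \<and> b \<in> span B} = UNIV"
    using S(2) unfolding finite_codimension_def by blast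
  have "x = 0" if "x \<in> S" "g x = 0" "x - t *\<^sub>R c \<in> span B" for x t
  proof -
    have "x - t *\<^sub>R c \<in> S \<inter> span B"
      using that c(1) S(1) by (auto intro: subspace_diff subspace_scale)
    then have "x = t *\<^sub>R c"
      using B(2) by simp
    then show ?thesis
      using that(2) c(2) by (simp add: linear_cmul[OF g])
  qed
  then have "S \<inter> {x. g x = 0} \<inter> span (insert c B) = {0}"
    using subspace_0[OF S(1)] span_zero[of "insert c B"] linear_0[OF g] by (auto simp: span_insert)
  moreover have "\<exists>s b. x = s + b \<and> s \<in> S \<inter> {x. g x = 0} \<and> b \<in> span (insert c B)" for x
  proof -
    obtain s b where sb: "x = s + b" "s \<in> S" "b \<in> span B"
      using B(3) by blast
    let ?k = "(g s / g c) *\<^sub>R c"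
    have "s - ?k \<in> S \<inter> {x. g x = 0}"
      using sb(2) c S(1)
      by (auto simp: linear_diff[OF g] linear_cmul[OF g] intro: subspace_diff subspace_scale)
    moreover have "?k + b \<in> span (insert c B)"
      using sb(3) by (auto simp: span_insert intro!: exI[of _ "g s / g c"])
    ultimately show ?thesis
      using sb(1) by (intro exI[of _ "s - ?k"] exI[of _ "?k + b"]) simp
  qed
  ultimately show ?thesis
    unfolding finite_codimension_def using B(1)
    by (intro exI[of _ "insert c B"]) (auto simp: set_eq_iff)
qed

lemma common_kernel_of_finitely_many_functionals:
  fixes g :: "'i \<Rightarrow> 'a::locally_convex_t2_space \<Rightarrow> real"
  assumes "finite I" "\<And>i. i \<in> I \<Longrightarrow> continuous_linear (g i)"
  shows "subspace {x. \<forall>i\<in>I. g i x = 0} \<and> closed {x. \<forall>i\<in>I. g i x = 0}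
    \<and> finite_codimension {x. \<forall>i\<in>I. g i x = 0}"
  using assms
proof (induction I)
  case empty
  have "finite_codimension (UNIV :: 'a set)"
    unfolding finite_codimension_def by (intro exI[of _ "{}"]) auto
  then show ?case
    by simp
next
  case (insert i I)
  let ?N = "{x. \<forall>i\<in>I. g i x = 0}"
  have g: "linear (g i)" "continuous_on UNIV (g i)"
    using insert.prems by (auto simp: continuous_linear_def)
  have eq: "{x. \<forall>i\<in>insert i I. g i x = 0} = ?N \<inter> {x. g i x = 0}"
    by auto
  have "closed (g i -` {0})"
    using g(2) by (intro closed_vimage) auto
  then have "closed {x. g i x = 0}"
    by (simp add: vimage_def)
  moreover have "subspace {x. g i x = 0}"
    using g(1) by (rule linear_subspace_kernel)
  ultimately show ?case
    unfolding eq using insert g(1)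
    by (auto intro: subspace_inter closed_Int finite_codimension_Int_kernel)
qed

text \<open>The inequalities see \<open>y\<close> only modulo the common kernel \<open>N\<close> of the \<open>g i\<close>, which has a
  finite-dimensional complement \<open>span B\<close>. Splitting \<open>y = n + s\<close>, the unknown \<open>n \<in> N\<close> enters only
  through the equation, and can be removed by weakening it to \<open>T w + S s - c \<in> S ` N\<close>. The closedness
  of \<open>S ` N\<close> is exactly what keeps this condition admissible. The remaining unknown \<open>s\<close> ranges over
  a finite-dimensional space. To eliminate it inside one fixed space, the solution set \<open>Q\<close> of pairs
  \<open>(w, s)\<close>, with \<open>s\<close> any vector, is enlarged by the span of \<open>{0} \<times> B\<close> and then cut at second
  component zero.\<close>
lemma generalized_polyhedral_convex_exists_solution:
  fixes T :: "'w::locally_convex_t2_space \<Rightarrow> 'e::locally_convex_t2_space"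
    and S :: "'y::locally_convex_t2_space \<Rightarrow> 'e"
    and f :: "'i \<Rightarrow> 'w \<Rightarrow> real" and g :: "'i \<Rightarrow> 'y \<Rightarrow> real"
  assumes T: "continuous_linear T" and S: "continuous_linear S"
    and S_closed: "closed_under_finite_codim_subspaces S"
    and I: "finite I" and f: "\<And>i. i \<in> I \<Longrightarrow> continuous_linear (f i)"
    and g: "\<And>i. i \<in> I \<Longrightarrow> continuous_linear (g i)"
  shows "generalized_polyhedral_convex {w. \<exists>y. T w + S y = c \<and> (\<forall>i\<in>I. f i w + g i y \<le> b i)}"
proof -
  define N where "N = {y. \<forall>i\<in>I. g i y = 0}"
  have N: "subspace N" "closed N" "finite_codimension N"
    using common_kernel_of_finitely_many_functionals[OF I g] by (auto simp: N_def)
  obtain B where B: "finite B" "{s + b | s b. s \<in> N \<and> b \<in> span B} = UNIV"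
    using N(3) unfolding finite_codimension_def by blast
  have S_lin: "linear S"
    using S by (simp add: continuous_linear_def)
  have g_lin: "linear (g i)" if "i \<in> I" for i
    using g[OF that] by (simp add: continuous_linear_def)
  have SN: "affine (S ` N)" "closed (S ` N)"
    using S_closed N linear_subspace_image[OF S_lin N(1)] subspace_imp_affine
    by (auto simp: closed_under_finite_codim_subspaces_def)
  define Q where "Q = {z \<in> {z. T (fst z) + S (snd z) + - c \<in> S ` N}.
    \<forall>i\<in>I. f i (fst z) + g i (snd z) \<le> b i}"
  have "generalized_polyhedral_convex Q"
    unfolding Q_def using SN
    by (intro generalized_polyhedral_convexI closed_affine_vimage I continuous_linear_add
        continuous_linear_compose[OF T continuous_linear_fst]
        continuous_linear_compose[OF S continuous_linear_snd]
        continuous_linear_compose[OF f continuous_linear_fst]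
        continuous_linear_compose[OF g continuous_linear_snd])
  then have "generalized_polyhedral_convex {z. \<exists>s\<in>span (Pair 0 ` B). z + s \<in> Q}"
    using B(1) by (intro generalized_polyhedral_convex_plus_span) auto
  then have "generalized_polyhedral_convex
      {w. (w, 0) \<in> {z. \<exists>s\<in>span (Pair 0 ` B). z + s \<in> Q}}"
    by (rule generalized_polyhedral_convex_vimage)
      (intro continuous_linear_Pair continuous_linear_ident continuous_linear_zero)
  moreover have "span (Pair (0::'w) ` B) = Pair 0 ` span B"
    by (rule linear_span_image) (simp add: linear_iff)
  moreover have "(\<exists>s\<in>span B. (w, s) \<in> Q) \<longleftrightarrow>
      (\<exists>y. T w + S y = c \<and> (\<forall>i\<in>I. f i w + g i y \<le> b i))" for w
  proof
    assume "\<exists>s\<in>span B. (w, s) \<in> Q"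
    then obtain s n where s: "T w + S s - c = S n" "n \<in> N" "\<And>i. i \<in> I \<Longrightarrow> f i w + g i s \<le> b i"
      by (auto simp: Q_def)
    have "T w + S (s - n) = c"
      using s(1) by (simp add: linear_diff[OF S_lin] algebra_simps)
    moreover have "g i (s - n) = g i s" if "i \<in> I" for i
      using s(2) that by (simp add: N_def linear_diff[OF g_lin])
    ultimately show "\<exists>y. T w + S y = c \<and> (\<forall>i\<in>I. f i w + g i y \<le> b i)"
      using s(3) by (intro exI[of _ "s - n"]) simp
  next
    assume "\<exists>y. T w + S y = c \<and> (\<forall>i\<in>I. f i w + g i y \<le> b i)"
    then obtain y where y: "T w + S y = c" "\<And>i. i \<in> I \<Longrightarrow> f i w + g i y \<le> b i"
      by blast
    obtain n s where ns: "y = n + s" "n \<in> N" "s \<in> span B"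
      using B(2) by blast
    have "T w + S s - c = S (- n)"
      using y(1) by (auto simp: ns(1) linear_add[OF S_lin] linear_neg[OF S_lin] algebra_simps)
    moreover have "- n \<in> N"
      using N(1) ns(2) by (rule subspace_neg)
    moreover have "g i y = g i s" if "i \<in> I" for i
      using ns(2) that by (simp add: N_def ns(1) linear_add[OF g_lin])
    ultimately show "\<exists>s\<in>span B. (w, s) \<in> Q"
      using y(2) ns(3) by (intro bexI[of _ s]) (auto simp: Q_def)
  qed
  ultimately show ?thesis
    by simp
qed

section \<open>Composition of multifunctions\<close>

theorem theorem4p1:
  fixes F :: "'x::locally_convex_t2_space \<Rightarrow> 'y::locally_convex_t2_space set"
    and G :: "'y \<Rightarrow> 'z::locally_convex_t2_space set"
    and A1 :: "'x \<Rightarrow> 'u::locally_convex_t2_space" and A2 :: "'y \<Rightarrow> 'u"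
    and B1 :: "'y \<Rightarrow> 'v::locally_convex_t2_space" and B2 :: "'z \<Rightarrow> 'v"
    and u :: 'u and v :: 'v
    and p q :: nat
    and xs :: "nat \<Rightarrow> 'x \<Rightarrow> real" and ys1 ys2 :: "nat \<Rightarrow> 'y \<Rightarrow> real"
    and zs :: "nat \<Rightarrow> 'z \<Rightarrow> real" and \<alpha> \<beta> :: "nat \<Rightarrow> real"
  assumes "generalized_polyhedral_convex_mf F" and "generalized_polyhedral_convex_mf G"
    and "continuous_linear A1" and "continuous_linear A2"
    and "continuous_linear B1" and "continuous_linear B2"
    and "\<And>i. i \<in> {1..p} \<Longrightarrow> continuous_linear (xs i)"
    and "\<And>i. i \<in> {1..p} \<Longrightarrow> continuous_linear (ys1 i)"
    and "\<And>j. j \<in> {1..q} \<Longrightarrow> continuous_linear (ys2 j)"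
    and "\<And>j. j \<in> {1..q} \<Longrightarrow> continuous_linear (zs j)"
    and "gph F = {(x, y). A1 x + A2 y = u \<and> (\<forall>i\<in>{1..p}. xs i x + ys1 i y \<le> \<alpha> i)}"
    and "gph G = {(y, z). B1 y + B2 z = v \<and> (\<forall>j\<in>{1..q}. ys2 j y + zs j z \<le> \<beta> j)}"
    and "closed_under_finite_codim_subspaces (\<lambda>y. (A2 y, B1 y))"
  shows "generalized_polyhedral_convex_mf (mf_comp G F)"
proof -
  note F = assms(11) and G = assms(12)
  let ?f = "case_sum (\<lambda>i w. xs i (fst w)) (\<lambda>j w. zs j (snd w))"
  let ?g = "case_sum ys1 ys2"
  let ?b = "case_sum \<alpha> \<beta>"
  let ?I = "{1..p} <+> {1..q}"
  have "gph (mf_comp G F) =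
    {w. \<exists>y. (A1 (fst w), B2 (snd w)) + (A2 y, B1 y) = (u, v) \<and> (\<forall>k\<in>?I. ?f k w + ?g k y \<le> ?b k)}"
  proof -
    have "z \<in> mf_comp G F x \<longleftrightarrow> (\<exists>y. (x, y) \<in> gph F \<and> (y, z) \<in> gph G)" for x z
      by (auto simp: mf_comp_def gph_def)
    then have "gph (mf_comp G F) = {(x, z). \<exists>y. (x, y) \<in> gph F \<and> (y, z) \<in> gph G}"
      by (simp add: gph_def[of "mf_comp G F"])
    then show ?thesis
      unfolding F G by (auto simp: Plus_def ball_Un add.commute)
  qed
  moreover have "generalized_polyhedral_convex \<dots>"
  proof (rule generalized_polyhedral_convex_exists_solution)
    show "continuous_linear (\<lambda>w. (A1 (fst w), B2 (snd w)))"
      by (intro continuous_linear_Pair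
          continuous_linear_compose[OF assms(3) continuous_linear_fst]
          continuous_linear_compose[OF assms(6) continuous_linear_snd])
    show "continuous_linear (\<lambda>y. (A2 y, B1 y))"
      using assms(4,5) by (rule continuous_linear_Pair)
    show "finite ?I"
      by simp
    show "continuous_linear (?f k)" if "k \<in> ?I" for k
      using that
      by (auto intro!: continuous_linear_compose[OF assms(7) continuous_linear_fst]
          continuous_linear_compose[OF assms(10) continuous_linear_snd])
    show "continuous_linear (?g k)" if "k \<in> ?I" for k
      using that assms(8,9) by auto
  qed (rule assms(13))
  ultimately show ?thesis
    unfolding generalized_polyhedral_convex_mf_def by simp
qed

end
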